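(* Let $d\ge 1$ and $n\ge 1$ be integers and let $\lambda_1,\dots,\lambda_d\in(0,1]$ and $\phi_0,\dots,\phi_{2d}:[0,1]\to[0,1]$ be fixed Kolmogorov data as described in the context. Let $f\in C([0,1]^d)$ and let $g\in C([0,d])$ be an outer function of $f$, i.e. $$f(x_1,\dots,x_d)=\sum_{q=0}^{2d} g\Big(\sum_{p=1}^d\lambda_p\phi_q(x_p)\Big),\qquad (x_1,\dots,x_d)\in[0,1]^d .$$ Let $L_g$ be the continuous piecewise linear function on $[0,d]$ that interpolates $g$ at the knots of the uniform partition of $[0,d]$ of mesh size $\frac1n$, and let $$KB(f)_n(x_1,\dots,x_d)=\sum_{q=0}^{2d}L_g\Big(\sum_{i=1}^d\lambda_i\phi_q(x_i)\Big).$$ Then $$\|f-KB(f)_n\|_\infty\le\begin{cases}(2d+1)\,\omega\big(g,\tfrac1n\big), & \text{if } g\in C([0,d]),\\[2pt] \frac{2d+1}{2n}\|g'\|_\infty, & \text{if } g\in C^1([0,d]),\\[2pt] \frac{2d+1}{8n^2}\|g''\|_\infty, & \text{if } g\in C^2([0,d]).\end{cases}$$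
   Context: Kolmogorov data (Kolmogorov superposition theorem, Lorentz's version): fix numbers $0<\lambda_p\le 1$, $p=1,\dots,d$, and strictly increasing functions $\phi_q:[0,1]\to[0,1]$, $q=0,\dots,2d$, each Hölder continuous with exponent $\alpha\in(0,1)$, with the property that for every $f\in C([0,1]^d)$ there exists $g\in C([0,d])$ with $f(x_1,\dots,x_d)=\sum_{q=0}^{2d} g\big(\sum_{p=1}^d\lambda_p\phi_q(x_p)\big)$ on $[0,1]^d$. Such data exist by Lorentz's version of the Kolmogorov superposition theorem. The function $g$ is called the outer function of $f$. The uniform partition of $[0,d]$ of mesh size $1/n$ has knots $t_i=i/n$, $i=0,1,\dots,nd$; $L_g$ is affine on each $[t_{i-1},t_i]$ with $L_g(t_i)=g(t_i)$ for all $i$. The modulus of continuity is $\omega(g,h)=\sup\{|g(s)-g(t)|: s,t\in[0,d],\ |s-t|\le h\}$. The norm $\|\cdot\|_\infty$ denotes the supremum norm, on $[0,1]^d$ for $f-KB(f)_n$ and on $[0,d]$ for $g',g''$. *)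

theory Defs
  imports "HOL-Analysis.Analysis"
begin

text \<open>
  The dimension \<open>d\<close> is \<open>CARD('d)\<close> for a finite index type \<open>'d\<close>, so that points of the unit cube
  are vectors of type \<open>real ^ 'd\<close>.
\<close>

abbreviation unit_cube :: "(real ^ 'd) set" where
  "unit_cube \<equiv> cbox 0 1"

definition sup_norm_on :: "'a set \<Rightarrow> ('a \<Rightarrow> real) \<Rightarrow> real" where
  "sup_norm_on S f = (SUP x\<in>S. \<bar>f x\<bar>)"

definition modulus_of_continuity_on :: "real set \<Rightarrow> (real \<Rightarrow> real) \<Rightarrow> real \<Rightarrow> real" where
  "modulus_of_continuity_on S g h = Sup {\<bar>g s - g t\<bar> | s t. s \<in> S \<and> t \<in> S \<and> \<bar>s - t\<bar> \<le> h}"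

definition holder_continuous_on :: "real \<Rightarrow> real set \<Rightarrow> (real \<Rightarrow> real) \<Rightarrow> bool" where
  "holder_continuous_on \<alpha> S \<phi> \<longleftrightarrow>
     (\<exists>C. \<forall>x\<in>S. \<forall>y\<in>S. \<bar>\<phi> x - \<phi> y\<bar> \<le> C * \<bar>x - y\<bar> powr \<alpha>)"

definition kolmogorov_superposition ::
    "real ^ 'd \<Rightarrow> (nat \<Rightarrow> real \<Rightarrow> real) \<Rightarrow> (real \<Rightarrow> real) \<Rightarrow> real ^ 'd \<Rightarrow> real" where
  "kolmogorov_superposition \<Lambda> \<phi> g x =
     (\<Sum>q = 0..2 * CARD('d). g (\<Sum>p\<in>UNIV. \<Lambda> $ p * \<phi> q (x $ p)))"

definition outer_function ::
    "real ^ 'd \<Rightarrow> (nat \<Rightarrow> real \<Rightarrow> real) \<Rightarrow> (real ^ 'd \<Rightarrow> real) \<Rightarrow> (real \<Rightarrow> real) \<Rightarrow> bool" where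
  "outer_function \<Lambda> \<phi> f g \<longleftrightarrow>
     continuous_on {0..real CARD('d)} g \<and>
     (\<forall>x\<in>unit_cube. f x = kolmogorov_superposition \<Lambda> \<phi> g x)"

definition kolmogorov_data ::
    "real \<Rightarrow> real ^ 'd \<Rightarrow> (nat \<Rightarrow> real \<Rightarrow> real) \<Rightarrow> bool" where
  "kolmogorov_data \<alpha> \<Lambda> \<phi> \<longleftrightarrow>
     0 < \<alpha> \<and> \<alpha> < 1 \<and>
     (\<forall>p. 0 < \<Lambda> $ p \<and> \<Lambda> $ p \<le> 1) \<and>
     (\<forall>q \<in> {0..2 * CARD('d)}.
        \<phi> q \<in> {0..1} \<rightarrow> {0..1} \<and>
        strict_mono_on {0..1} (\<phi> q) \<and>
        holder_continuous_on \<alpha> {0..1} (\<phi> q)) \<and>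
     (\<forall>f. continuous_on unit_cube f \<longrightarrow> (\<exists>g. outer_function \<Lambda> \<phi> f g))"

text \<open>
  The pieces are closed intervals sharing their end points, so continuity of \<open>L\<close> on \<open>[0, d]\<close>
  is automatic.  Existence, and uniqueness on \<open>[0, d]\<close>, are proved below; values of \<open>L\<close>
  outside \<open>[0, d]\<close> are unconstrained.
\<close>

definition linear_interpolant :: "nat \<Rightarrow> nat \<Rightarrow> (real \<Rightarrow> real) \<Rightarrow> (real \<Rightarrow> real) \<Rightarrow> bool" where
  "linear_interpolant d n g L \<longleftrightarrow>
     (\<forall>i<n * d. \<exists>a b. \<forall>t\<in>{real i / real n..real (Suc i) / real n}. L t = a * t + b) \<and>
     (\<forall>i\<le>n * d. L (real i / real n) = g (real i / real n))"

lemma linear_interpolant_exists: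
  assumes "n \<ge> 1"
  shows "\<exists>L. linear_interpolant d n g L"
proof -
  define G where "G k = g (real_of_int k / real n)" for k :: int
  define L where "L t = G \<lfloor>n * t\<rfloor> + (n * t - \<lfloor>n * t\<rfloor>) * (G (\<lfloor>n * t\<rfloor> + 1) - G \<lfloor>n * t\<rfloor>)" for t :: real
  have n: "real n > 0" using assms by simp
  have knots: "L (real i / real n) = g (real i / real n)" for i :: nat
    using n by (simp add: L_def G_def)
  have aff: "L t = (n * (G (int i + 1) - G (int i))) * t + (G (int i) - i * (G (int i + 1) - G (int i)))"
    if t: "t \<in> {real i / real n..real (Suc i) / real n}" for t and i :: nat
  proof (cases "t = real (Suc i) / real n")
    case True
    have "L t = G (int i + 1)"
      using knots[of "Suc i"] by (simp add: True G_def add.commute)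
    moreover have "n * t = real i + 1" using True n by simp
    moreover have "real n * (G (int i + 1) - G (int i)) * t = (G (int i + 1) - G (int i)) * (real i + 1)"
      using \<open>n * t = real i + 1\<close> by (metis mult.assoc mult.commute)
    ultimately show ?thesis by (simp add: algebra_simps)
  next
    case False
    then have "real i \<le> n * t" "n * t < real i + 1"
      using t n by (auto simp: field_simps)
    then have "\<lfloor>n * t\<rfloor> = int i" by (intro floor_unique) auto
    then show ?thesis unfolding L_def by (simp add: algebra_simps)
  qed
  have "linear_interpolant d n g L"
    unfolding linear_interpolant_def using knots aff by blast
  then show ?thesis by blast
qed

lemma linear_interpolant_unique:
  assumes "n \<ge> 1" "linear_interpolant d n g L" "linear_interpolant d n g M" "t \<in> {0..real d}" 
  shows "L t = M t"
proof (cases "t = real d")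
  case True
  then have "t = real (n * d) / real n" using assms(1) by simp
  then show ?thesis using assms(2,3) unfolding linear_interpolant_def by (metis order_refl)
next
  case False
  define i where "i = nat \<lfloor>n * t\<rfloor>"
  have n: "real n > 0" using assms(1) by simp
  have nt: "0 \<le> n * t" "n * t < real (n * d)" using n assms(4) False by auto
  have fl: "real i \<le> n * t" "n * t < real (Suc i)" unfolding i_def using nt by linarith+
  have i: "i < n * d" using fl nt by linarith
  let ?u = "real i / real n" and ?v = "real (Suc i) / real n"
  have t: "t \<in> {?u..?v}" using fl n by (auto simp: field_simps)
  have uv: "?u < ?v" using n by (simp add: divide_strict_right_mono)
  obtain a b where ab: "\<And>s. s \<in> {?u..?v} \<Longrightarrow> L s = a * s + b"
    using assms(2) i unfolding linear_interpolant_def by blast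
  obtain a' b' where ab': "\<And>s. s \<in> {?u..?v} \<Longrightarrow> M s = a' * s + b'"
    using assms(3) i unfolding linear_interpolant_def by blast
  have "L ?u = M ?u" "L ?v = M ?v"
    using assms(2,3) i unfolding linear_interpolant_def by (metis less_imp_le Suc_leI)+
  then have e: "a * ?u + b = a' * ?u + b'" "a * ?v + b = a' * ?v + b'"
    using ab ab' uv by (metis atLeastAtMost_iff less_imp_le order_refl)+
  then have "(a - a') * (?v - ?u) = 0" by algebra
  then have "a = a'" using uv by (metis eq_iff_diff_eq_0 less_irrefl mult_eq_0_iff)
  with e have "b = b'" by simp
  show ?thesis using ab[OF t] ab'[OF t] \<open>a = a'\<close> \<open>b = b'\<close> by simp
qed

text \<open>
  Derivatives are taken relative to the set, so at the end points of a closed interval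
  they are one-sided; the library's \<open>C1_differentiable_on\<close> demands two-sided ones.
\<close>

definition C1_on :: "real set \<Rightarrow> (real \<Rightarrow> real) \<Rightarrow> (real \<Rightarrow> real) \<Rightarrow> bool" where
  "C1_on S g g' \<longleftrightarrow>
     (\<forall>t\<in>S. (g has_real_derivative g' t) (at t within S)) \<and> continuous_on S g'"

definition C2_on :: "real set \<Rightarrow> (real \<Rightarrow> real) \<Rightarrow> (real \<Rightarrow> real) \<Rightarrow> (real \<Rightarrow> real) \<Rightarrow> bool" where
  "C2_on S g g' g'' \<longleftrightarrow> C1_on S g g' \<and> C1_on S g' g''"

end

theory Submission
  imports Defs
begin

text \<open>
  The outer arguments lie in \<open>[0, d]\<close>, so the claim reduces to the one-dimensional error
  \<open>\<bar>g t - L t\<bar>\<close>, summed over \<open>2d + 1\<close> terms.  On a cell \<open>[u, v]\<close> of length \<open>h\<close> containing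
  \<open>t = (1 - \<theta>) u + \<theta> v\<close>, the error is \<open>(1 - \<theta>) (g u - g t) + \<theta> (g v - g t)\<close> up to sign.
  Bounding the differences by the modulus of continuity gives the first estimate; the mean value
  theorem gives \<open>2 \<theta> (1 - \<theta>) h \<parallel>g'\<parallel>\<close>; and in the second-order Taylor expansion at \<open>t\<close> the
  linear terms cancel, leaving \<open>\<theta> (1 - \<theta>) h\<^sup>2 \<parallel>g''\<parallel> / 2\<close>.  Finally \<open>\<theta> (1 - \<theta>) \<le> 1 / 4\<close>.
\<close>

section \<open>Attainable bounds from the supremum norm and the modulus of continuity\<close>

text \<open>A real supremum dominates its set only if that set is bounded above; here compactness of
  the image provides the bound.\<close>

lemma abs_le_sup_norm_on:
  assumes "compact S" "continuous_on S f" "x \<in> S"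
  shows "\<bar>f x\<bar> \<le> sup_norm_on S f"
proof -
  have "compact ((\<lambda>x. \<bar>f x\<bar>) ` S)"
    using assms by (intro compact_continuous_image continuous_intros)
  then have "bdd_above ((\<lambda>x. \<bar>f x\<bar>) ` S)"
    by (intro bounded_imp_bdd_above compact_imp_bounded)
  then show ?thesis
    unfolding sup_norm_on_def using assms(3) by (rule cSUP_upper2) simp
qed

lemma abs_diff_le_modulus_of_continuity_on:
  assumes "compact S" "continuous_on S g" "s \<in> S" "t \<in> S" "\<bar>s - t\<bar> \<le> h"
  shows "\<bar>g s - g t\<bar> \<le> modulus_of_continuity_on S g h"
  unfolding modulus_of_continuity_on_def
proof (rule cSup_upper)
  show "\<bar>g s - g t\<bar> \<in> {\<bar>g s - g t\<bar> |s t. s \<in> S \<and> t \<in> S \<and> \<bar>s - t\<bar> \<le> h}"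
    using assms by blast
  show "bdd_above {\<bar>g s - g t\<bar> |s t. s \<in> S \<and> t \<in> S \<and> \<bar>s - t\<bar> \<le> h}"
  proof (rule bdd_aboveI)
    fix y assume "y \<in> {\<bar>g s - g t\<bar> |s t. s \<in> S \<and> t \<in> S \<and> \<bar>s - t\<bar> \<le> h}"
    then obtain a b where "y = \<bar>g a - g b\<bar>" "a \<in> S" "b \<in> S" by blast
    \<comment> \<open>By the triangle inequality, the oscillation of \<open>g\<close> is at most
      twice its supremum norm, whatever \<open>h\<close> is.\<close>
    then show "y \<le> 2 * sup_norm_on S g"
      using abs_le_sup_norm_on[OF assms(1,2), of a] abs_le_sup_norm_on[OF assms(1,2), of b]
      by linarith
  qed
qed

section \<open>Second-order Taylor estimate on an interval\<close>

text \<open>Subtracting the claimed bound from the Taylor remainder gives a function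
  \<open>r\<close> with \<open>r t = 0\<close>. Since \<open>g'\<close> is
  \<open>M\<close>-Lipschitz, \<open>r'\<close> is nonnegative to the left of \<open>t\<close> and
  nonpositive to the right, so \<open>r\<close> is maximal at \<open>t\<close>. Derivatives within
  \<open>S\<close> allow \<open>t\<close> to be an end point.\<close>

lemma taylor_order2_upper:
  fixes g g' g'' :: "real \<Rightarrow> real"
  assumes S: "is_interval S" and t: "t \<in> S" and s: "s \<in> S"
    and g: "\<And>x. x \<in> S \<Longrightarrow> (g has_real_derivative g' x) (at x within S)"
    and g': "\<And>x. x \<in> S \<Longrightarrow> (g' has_real_derivative g'' x) (at x within S)"
    and M: "\<And>x. x \<in> S \<Longrightarrow> \<bar>g'' x\<bar> \<le> M"
  shows "g s - g t - g' t * (s - t) \<le> M * (s - t)\<^sup>2 / 2"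
proof -
  define r where "r x = g x - g t - g' t * (x - t) - M * (x - t)\<^sup>2 / 2" for x
  define r' where "r' x = g' x - g' t - M * (x - t)" for x
  have r: "(r has_real_derivative r' x) (at x within S)" if "x \<in> S" for x
    unfolding r_def r'_def
    by (rule derivative_eq_intros g[OF that] refl | simp)+
  have lip: "\<bar>g' x - g' t\<bar> \<le> M * \<bar>x - t\<bar>" if "x \<in> S" for x
    using field_differentiable_bound[of S g' g'' M x t] S g' M t that
    by (simp add: is_interval_convex_1)
  \<comment> \<open>Derivatives within \<open>S\<close> restrict to derivatives within
    \<open>{a..b}\<close>, which is all the mean value theorem needs.\<close>
  have mvt: "\<exists>x\<in>{a<..<b}. r b - r a = r' x * (b - a)" if "a < b" "a \<in> S" "b \<in> S" for a b
  proof -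
    have sub: "{a..b} \<subseteq> S"
      using S that by (metis is_interval_1 atLeastAtMost_iff subsetI)
    have "(r has_derivative (*) (r' x)) (at x within {a..b})" if "a \<le> x" "x \<le> b" for x
      using r[of x] sub that
      by (meson atLeastAtMost_iff has_field_derivative_def has_derivative_subset subsetD)
    then show ?thesis by (rule mvt_simple[OF \<open>a < b\<close>])
  qed
  have in_S: "x \<in> S" if "a \<le> x" "x \<le> b" "a \<in> S" "b \<in> S" for a b x
    using S that by (metis is_interval_1)
  have "r s \<le> r t"
  proof (cases s t rule: linorder_cases)
    case less
    then obtain x where x: "s < x" "x < t" "r t - r s = r' x * (t - s)"
      using mvt[of s t] s t by auto
    then have "0 \<le> r' x"
      using lip[of x] in_S[of s x t] s t unfolding r'_def by (simp add: abs_if algebra_simps split: if_splits)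
    then show ?thesis using x less by (metis diff_ge_0_iff_ge less_imp_le mult_nonneg_nonneg)
  next
    case greater
    then obtain x where x: "t < x" "x < s" "r s - r t = r' x * (s - t)"
      using mvt[of t s] s t by auto
    then have "r' x \<le> 0"
      using lip[of x] in_S[of t x s] s t unfolding r'_def by (simp add: abs_if algebra_simps split: if_splits)
    then show ?thesis using x greater by (metis diff_ge_0_iff_ge diff_le_0_iff_le less_imp_le mult_nonpos_nonneg)
  qed simp
  then show ?thesis unfolding r_def by simp
qed

lemma taylor_order2_bound:
  fixes g g' g'' :: "real \<Rightarrow> real"
  assumes "is_interval S" "t \<in> S" "s \<in> S"
    and "\<And>x. x \<in> S \<Longrightarrow> (g has_real_derivative g' x) (at x within S)"
    and "\<And>x. x \<in> S \<Longrightarrow> (g' has_real_derivative g'' x) (at x within S)"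
    and "\<And>x. x \<in> S \<Longrightarrow> \<bar>g'' x\<bar> \<le> M"
  shows "\<bar>g s - g t - g' t * (s - t)\<bar> \<le> M * (s - t)\<^sup>2 / 2"
proof -
  \<comment> \<open>The lower bound is the upper bound for \<open>- g\<close>.\<close>
  have "- g s - - g t - - g' t * (s - t) \<le> M * (s - t)\<^sup>2 / 2"
    using assms
    by (intro taylor_order2_upper[where S = S and g' = "\<lambda>x. - g' x" and g'' = "\<lambda>x. - g'' x"] DERIV_minus)
      auto
  with taylor_order2_upper[OF assms] show ?thesis by linarith
qed

section \<open>Interpolation error on a single cell\<close>

text \<open>Common start of the three error estimates, which differ only in how they bound the
  differences of \<open>g\<close>. The weight of each end point is proportional to the distance of
  \<open>t\<close> from the other one; this produces the factor \<theta> (1 - \<theta>)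
  later.\<close>

lemma linear_interpolant_cell:
  assumes n: "n \<ge> 1" and d: "d \<ge> 1" and L: "linear_interpolant d n g L"
    and t: "t \<in> {0..real d}"
  obtains u v \<theta> where "u \<in> {0..real d}" "v \<in> {0..real d}" "0 \<le> \<theta>" "\<theta> \<le> 1"
    "t - u = \<theta> / real n" "v - t = (1 - \<theta>) / real n"
    "g t - L t = (1 - \<theta>) * (g t - g u) + \<theta> * (g t - g v)"
proof -
  \<comment> \<open>At a knot \<open>t > 0\<close> this is the cell on its left, so that \<open>t = d\<close> is covered; at \<open>t = 0\<close> the
    conversion truncates \<open>- 1\<close> to \<open>0\<close>.\<close>
  define i where "i = nat (\<lceil>n * t\<rceil> - 1)"
  have n0: "real n > 0" using n by simp
  have nt: "0 \<le> n * t" "n * t \<le> real (n * d)" using n0 t by auto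
  have fl: "real i \<le> n * t" "n * t \<le> real (Suc i)" unfolding i_def using nt by linarith+
  \<comment> \<open>At \<open>t = 0\<close> the index is 0, which is a legitimate cell only if there
    is at least one.\<close>
  have nd: "n * d > 0" using n d by simp
  have "\<lceil>n * t\<rceil> \<le> int (n * d)" using nt(2) by (simp add: ceiling_le_iff)
  then have i: "i < n * d" unfolding i_def using nd by linarith
  let ?u = "real i / real n" and ?v = "real (Suc i) / real n"
  define \<theta> where "\<theta> = n * t - i"
  have tcell: "t \<in> {?u..?v}" using fl n0 by (auto simp: field_simps)
  have uv: "?u < ?v" using n0 by (simp add: divide_strict_right_mono)
  obtain a b where ab: "\<And>s. s \<in> {?u..?v} \<Longrightarrow> L s = a * s + b"
    using L i unfolding linear_interpolant_def by blast
  have knots: "L ?u = g ?u" "L ?v = g ?v"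
    using L i unfolding linear_interpolant_def by (metis less_imp_le Suc_leI)+
  have "L ?u = a * ?u + b" "L ?v = a * ?v + b" "L t = a * t + b"
    using ab tcell uv by (auto simp del: of_nat_Suc)
  moreover have "t = (1 - \<theta>) * ?u + \<theta> * ?v"
    unfolding \<theta>_def using n0 by (simp add: field_simps)
  ultimately have Lt: "L t = (1 - \<theta>) * g ?u + \<theta> * g ?v"
    using knots by algebra
  have "real (Suc i) \<le> real (n * d)" using i by (metis Suc_leI of_nat_le_iff)
  then have "?v \<le> real d" using n0 by (simp add: field_simps)
  show ?thesis
  proof (rule that)
    show "?u \<in> {0..real d}" "?v \<in> {0..real d}" using \<open>?v \<le> real d\<close> uv by auto
    show "0 \<le> \<theta>" "\<theta> \<le> 1" using fl unfolding \<theta>_def by auto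
    show "t - ?u = \<theta> / real n" "?v - t = (1 - \<theta>) / real n"
      unfolding \<theta>_def using n0 by (auto simp: field_simps)
    show "g t - L t = (1 - \<theta>) * (g t - g ?u) + \<theta> * (g t - g ?v)"
      unfolding Lt by (simp add: algebra_simps)
  qed
qed

lemma abs_convex_combination_le:
  fixes x y :: real
  assumes "0 \<le> \<theta>" "\<theta> \<le> 1" "\<bar>x\<bar> \<le> A" "\<bar>y\<bar> \<le> B"
  shows "\<bar>(1 - \<theta>) * x + \<theta> * y\<bar> \<le> (1 - \<theta>) * A + \<theta> * B"
proof -
  have "\<bar>(1 - \<theta>) * x\<bar> \<le> (1 - \<theta>) * A" "\<bar>\<theta> * y\<bar> \<le> \<theta> * B"
    using assms by (auto simp: abs_mult intro: mult_left_mono)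
  then show ?thesis by linarith
qed

lemma mult_one_minus_le_quarter: "\<theta> * (1 - \<theta>) \<le> 1 / 4" for \<theta> :: real
  using zero_le_power2[of "\<theta> - 1 / 2"] by (simp add: power2_eq_square algebra_simps)

lemma linear_interpolant_error_modulus:
  assumes "n \<ge> 1" "d \<ge> 1" "linear_interpolant d n g L" "t \<in> {0..real d}"
    and g: "continuous_on {0..real d} g"
  shows "\<bar>g t - L t\<bar> \<le> modulus_of_continuity_on {0..real d} g (1 / real n)" (is "_ \<le> ?\<omega>")
proof -
  obtain u v \<theta> where uv: "u \<in> {0..real d}" "v \<in> {0..real d}" and \<theta>: "0 \<le> \<theta>" "\<theta> \<le> 1"
    and tu: "t - u = \<theta> / real n" and vt: "v - t = (1 - \<theta>) / real n"
    and err: "g t - L t = (1 - \<theta>) * (g t - g u) + \<theta> * (g t - g v)"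
    using linear_interpolant_cell[OF assms(1-4)] by blast
  \<comment> \<open>The distances to the two end points are nonnegative and add up to the mesh size,
    so neither exceeds it.\<close>
  have "\<theta> / real n \<ge> 0" "(1 - \<theta>) / real n \<ge> 0" "\<theta> / real n + (1 - \<theta>) / real n = 1 / real n"
    using \<theta> by (auto simp flip: add_divide_distrib)
  then have "\<bar>t - u\<bar> \<le> 1 / real n" "\<bar>t - v\<bar> \<le> 1 / real n"
    using tu vt by linarith+
  then have "\<bar>g t - g u\<bar> \<le> ?\<omega>" "\<bar>g t - g v\<bar> \<le> ?\<omega>"
    using uv assms(4) g by (auto intro!: abs_diff_le_modulus_of_continuity_on)
  then have "\<bar>g t - L t\<bar> \<le> (1 - \<theta>) * ?\<omega> + \<theta> * ?\<omega>"
    unfolding err using \<theta> by (intro abs_convex_combination_le)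
  then show ?thesis by (simp add: algebra_simps)
qed

lemma linear_interpolant_error_C1:
  assumes "n \<ge> 1" "d \<ge> 1" "linear_interpolant d n g L" "t \<in> {0..real d}"
    and C1: "C1_on {0..real d} g g'"
  shows "\<bar>g t - L t\<bar> \<le> sup_norm_on {0..real d} g' / (2 * real n)" (is "_ \<le> ?M / _")
proof -
  obtain u v \<theta> where uv: "u \<in> {0..real d}" "v \<in> {0..real d}" and \<theta>: "0 \<le> \<theta>" "\<theta> \<le> 1"
    and tu: "t - u = \<theta> / real n" and vt: "v - t = (1 - \<theta>) / real n"
    and err: "g t - L t = (1 - \<theta>) * (g t - g u) + \<theta> * (g t - g v)"
    using linear_interpolant_cell[OF assms(1-4)] by blast
  have M: "\<bar>g' x\<bar> \<le> ?M" if "x \<in> {0..real d}" for x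
    using C1 that unfolding C1_on_def by (intro abs_le_sup_norm_on) auto
  then have M0: "?M \<ge> 0" using assms(4) abs_ge_zero order_trans by blast
  have lip: "\<bar>g t - g x\<bar> \<le> ?M * \<bar>t - x\<bar>" if "x \<in> {0..real d}" for x
    using field_differentiable_bound[of "{0..real d}" g g' ?M t x] C1 M assms(4) that
    unfolding C1_on_def by auto
  have "\<bar>t - u\<bar> = \<theta> / real n" "\<bar>t - v\<bar> = (1 - \<theta>) / real n"
    using tu vt \<theta> by (auto simp: abs_minus_commute[of t v])
  then have "\<bar>g t - g u\<bar> \<le> ?M * (\<theta> / real n)" "\<bar>g t - g v\<bar> \<le> ?M * ((1 - \<theta>) / real n)"
    using lip uv by metis+
  then have "\<bar>g t - L t\<bar> \<le> (1 - \<theta>) * (?M * (\<theta> / real n)) + \<theta> * (?M * ((1 - \<theta>) / real n))"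
    unfolding err using \<theta> by (intro abs_convex_combination_le)
  \<comment> \<open>Both end points contribute the same amount, hence the factor 2; with the maximum
    1/4 it leaves the constant 1/2.\<close>
  also have "\<dots> = (2 * ?M / real n) * (\<theta> * (1 - \<theta>))"
    by (simp add: field_simps)
  also have "\<dots> \<le> (2 * ?M / real n) * (1 / 4)"
    using M0 by (intro mult_left_mono mult_one_minus_le_quarter) auto
  finally show ?thesis by simp
qed

lemma linear_interpolant_error_C2:
  assumes "n \<ge> 1" "d \<ge> 1" "linear_interpolant d n g L" "t \<in> {0..real d}"
    and C2: "C2_on {0..real d} g g' g''"
  shows "\<bar>g t - L t\<bar> \<le> sup_norm_on {0..real d} g'' / (8 * (real n)\<^sup>2)" (is "_ \<le> ?M / _")
proof -
  obtain u v \<theta> where uv: "u \<in> {0..real d}" "v \<in> {0..real d}" and \<theta>: "0 \<le> \<theta>" "\<theta> \<le> 1"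
    and tu: "t - u = \<theta> / real n" and vt: "v - t = (1 - \<theta>) / real n"
    and err: "g t - L t = (1 - \<theta>) * (g t - g u) + \<theta> * (g t - g v)"
    using linear_interpolant_cell[OF assms(1-4)] by blast
  have M: "\<bar>g'' x\<bar> \<le> ?M" if "x \<in> {0..real d}" for x
    using C2 that unfolding C2_on_def C1_on_def by (intro abs_le_sup_norm_on) auto
  then have M0: "?M \<ge> 0" using assms(4) abs_ge_zero order_trans by blast
  \<comment> \<open>\<open>R\<close> is the negated Taylor remainder at \<open>t\<close>. Replacing
    the differences \<open>g t - g x\<close> by \<open>R x\<close> leaves the convex combination
    unchanged, because (1 - \<theta>) (u - t) + \<theta> (v - t) = 0.\<close>
  define R where "R x = g t - g x + g' t * (x - t)" for x
  have R: "\<bar>R x\<bar> \<le> ?M * (x - t)\<^sup>2 / 2" if "x \<in> {0..real d}" for x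
  proof -
    have "\<bar>g x - g t - g' t * (x - t)\<bar> \<le> ?M * (x - t)\<^sup>2 / 2"
      using C2 M assms(4) that unfolding C2_on_def C1_on_def
      by (intro taylor_order2_bound[where S = "{0..real d}" and g'' = g'']) auto
    then show ?thesis unfolding R_def by linarith
  qed
  have ut: "u - t = - (\<theta> / real n)" using tu by simp
  have "\<bar>R u\<bar> \<le> ?M * (\<theta> / real n)\<^sup>2 / 2" "\<bar>R v\<bar> \<le> ?M * ((1 - \<theta>) / real n)\<^sup>2 / 2"
    using R[OF uv(1)] R[OF uv(2)] unfolding ut vt by simp_all
  moreover have "g t - L t = (1 - \<theta>) * R u + \<theta> * R v"
    unfolding err R_def ut vt by (simp add: algebra_simps)
  ultimately have "\<bar>g t - L t\<bar>
      \<le> (1 - \<theta>) * (?M * (\<theta> / real n)\<^sup>2 / 2) + \<theta> * (?M * ((1 - \<theta>) / real n)\<^sup>2 / 2)"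
    using \<theta> by (simp only: abs_convex_combination_le)
  \<comment> \<open>Uses (1 - \<theta>) \<theta>^2 + \<theta> (1 - \<theta>)^2 = \<theta> (1 -
    \<theta>).\<close>
  also have "\<dots> = (?M / (2 * (real n)\<^sup>2)) * (\<theta> * (1 - \<theta>))"
    using assms(1) by (simp add: divide_simps power2_eq_square) algebra
  also have "\<dots> \<le> (?M / (2 * (real n)\<^sup>2)) * (1 / 4)"
    using M0 by (intro mult_left_mono mult_one_minus_le_quarter) auto
  finally show ?thesis by simp
qed

section \<open>From one variable to the superposition\<close>

text \<open>Each of the \<open>CARD('d)\<close> summands lies in [0, 1]. This keeps the outer
  arguments where \<open>L\<close> is determined by \<open>g\<close>.\<close>

lemma inner_sum_in_interval:
  fixes \<Lambda> x :: "real ^ 'd"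
  assumes "kolmogorov_data \<alpha> \<Lambda> \<phi>" "q \<le> 2 * CARD('d)" "x \<in> unit_cube"
  shows "(\<Sum>p\<in>UNIV. \<Lambda> $ p * \<phi> q (x $ p)) \<in> {0..real CARD('d)}"
proof -
  have \<Lambda>: "0 < \<Lambda> $ p" "\<Lambda> $ p \<le> 1" for p
    using assms(1) unfolding kolmogorov_data_def by blast+
  have "\<phi> q \<in> {0..1} \<rightarrow> {0..1}"
    using assms(1,2) unfolding kolmogorov_data_def by simp
  moreover have "x $ p \<in> {0..1}" for p
    using assms(3) by (simp add: mem_box_cart)
  ultimately have "\<phi> q (x $ p) \<in> {0..1}" for p by blast
  then have "0 \<le> \<Lambda> $ p * \<phi> q (x $ p)" "\<Lambda> $ p * \<phi> q (x $ p) \<le> 1" for p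
    using \<Lambda>[of p] by (auto intro: mult_le_one simp: less_imp_le)
  then show ?thesis
    using sum_bounded_above[of UNIV "\<lambda>p. \<Lambda> $ p * \<phi> q (x $ p)" 1] by (simp add: sum_nonneg)
qed

text \<open>Any uniform bound \<open>B\<close> on the one-dimensional error serves, so all three
  cases of the theorem share this step. The triangle inequality over the indices 0, ..., 2d yields
  the factor 2d + 1.\<close>

lemma kolmogorov_superposition_error:
  fixes \<Lambda> :: "real ^ 'd" and f :: "real ^ 'd \<Rightarrow> real"
  assumes data: "kolmogorov_data \<alpha> \<Lambda> \<phi>" and f: "outer_function \<Lambda> \<phi> f g"
    and B: "\<And>t. t \<in> {0..real CARD('d)} \<Longrightarrow> \<bar>g t - L t\<bar> \<le> B"
  shows "sup_norm_on unit_cube (\<lambda>x. f x - kolmogorov_superposition \<Lambda> \<phi> L x)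
    \<le> (2 * real CARD('d) + 1) * B"
  unfolding sup_norm_on_def
proof (rule cSUP_least)
  show "unit_cube \<noteq> ({} :: (real ^ 'd) set)" by (simp add: interval_ne_empty_cart)
  fix x :: "real ^ 'd" assume x: "x \<in> unit_cube"
  let ?s = "\<lambda>q. \<Sum>p\<in>UNIV. \<Lambda> $ p * \<phi> q (x $ p)"
  have "f x - kolmogorov_superposition \<Lambda> \<phi> L x = (\<Sum>q = 0..2 * CARD('d). g (?s q) - L (?s q))"
    using f x unfolding outer_function_def kolmogorov_superposition_def
    by (simp add: sum_subtractf)
  also have "\<bar>\<dots>\<bar> \<le> (\<Sum>q = 0..2 * CARD('d). \<bar>g (?s q) - L (?s q)\<bar>)"
    by (rule sum_abs)
  also have "\<dots> \<le> (\<Sum>q = 0..2 * CARD('d). B)"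
    by (intro sum_mono B inner_sum_in_interval[OF data _ x]) simp
  also have "\<dots> = (2 * real CARD('d) + 1) * B" by (simp add: algebra_simps)
  finally show "\<bar>f x - kolmogorov_superposition \<Lambda> \<phi> L x\<bar> \<le> (2 * real CARD('d) + 1) * B" .
qed

theorem theorem5:
  fixes \<alpha> :: real and \<Lambda> :: "real ^ 'd" and \<phi> :: "nat \<Rightarrow> real \<Rightarrow> real"
    and f :: "real ^ 'd \<Rightarrow> real" and g L :: "real \<Rightarrow> real" and n :: nat
  assumes "n \<ge> 1"
    and "kolmogorov_data \<alpha> \<Lambda> \<phi>"
    and "continuous_on unit_cube f"
    and "outer_function \<Lambda> \<phi> f g"
    and "linear_interpolant CARD('d) n g L"
  shows "sup_norm_on unit_cube (\<lambda>x. f x - kolmogorov_superposition \<Lambda> \<phi> L x)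
           \<le> (2 * real CARD('d) + 1) * modulus_of_continuity_on {0..real CARD('d)} g (1 / real n) \<and>
         (\<forall>g'. C1_on {0..real CARD('d)} g g' \<longrightarrow>
           sup_norm_on unit_cube (\<lambda>x. f x - kolmogorov_superposition \<Lambda> \<phi> L x)
             \<le> (2 * real CARD('d) + 1) / (2 * real n) * sup_norm_on {0..real CARD('d)} g') \<and>
         (\<forall>g' g''. C2_on {0..real CARD('d)} g g' g'' \<longrightarrow>
           sup_norm_on unit_cube (\<lambda>x. f x - kolmogorov_superposition \<Lambda> \<phi> L x)
             \<le> (2 * real CARD('d) + 1) / (8 * (real n)\<^sup>2) * sup_norm_on {0..real CARD('d)} g'')"
proof (intro conjI allI impI)
  have d: "CARD('d) \<ge> 1" by (simp add: Suc_leI)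
  note error = kolmogorov_superposition_error[OF assms(2,4)]
  note bounds = linear_interpolant_error_modulus linear_interpolant_error_C1
    linear_interpolant_error_C2
  note bounds = bounds[OF assms(1) d assms(5)]
  let ?err = "sup_norm_on unit_cube (\<lambda>x. f x - kolmogorov_superposition \<Lambda> \<phi> L x)"
  have "continuous_on {0..real CARD('d)} g"
    using assms(4) unfolding outer_function_def by blast
  then show "?err \<le> (2 * real CARD('d) + 1)
      * modulus_of_continuity_on {0..real CARD('d)} g (1 / real n)"
    by (intro error bounds)
  show "?err \<le> (2 * real CARD('d) + 1) / (2 * real n) * sup_norm_on {0..real CARD('d)} g'"
    if "C1_on {0..real CARD('d)} g g'" for g'
    using error[OF bounds(2)[OF _ that]] by simp
  show "?err \<le> (2 * real CARD('d) + 1) / (8 * (real n)\<^sup>2) * sup_norm_on {0..real CARD('d)} g''"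
    if "C2_on {0..real CARD('d)} g g' g''" for g' g''
    using error[OF bounds(3)[OF _ that]] by simp
qed

end
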